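(* Consider the planar two-dumbbell problem with nontrivial dumbbells. Let $L^2(r)$ denote the value of $L^2$ for which $(r,0,0)$ is a colinear non-overlapped relative equilibrium ($\theta_1=\theta_2=0$, $r>x_{11}\ell_1+x_{22}\ell_2$). Then a colinear non-overlapped relative equilibrium at radius $r$ is (energetically) stable whenever $\partial_rL^2(r)>0$.
   Context: Planar two-dumbbell problem: two dumbbells with total masses $M_1,M_2>0$, $M_1+M_2=1$, move in a plane under Newtonian gravity ($G=1$). Dumbbell $i$ consists of two point masses $M_ix_{i1}$, $M_ix_{i2}$ ($x_{i1}+x_{i2}=1$) joined by a massless rod of length $\ell_i$, with $\ell_1+\ell_2=1$. Nontrivial means $x_{ij}\in(0,1)$, $\ell_i>0$ and $r>0$. Let $\vec r$ be the vector from the center of mass of dumbbell 1 to that of dumbbell 2, $r=|\vec r|$, and $\theta_i$ the angle between $\vec r$ and the rod of dumbbell $i$. In a frame with first axis along $\vec r$ and origin at the system's center of mass, mass $j$ of dumbbell $i$ is at $$\vec r_{ij}=(-1)^iM_nr(1,0)+(-1)^jx_{ik}\ell_i(\cos\theta_i,\sin\theta_i),\qquad n\ne i,\ k\ne j,$$ with all indices in $\{1,2\}$. Let $d_{uv}=|\vec r_{1u}-\vec r_{2v}|$ and $B_1=\frac{x_{11}x_{12}}{M_2}\ell_1^2$, $B_2=\frac{x_{21}x_{22}}{M_1}\ell_2^2$. The (scaled) amended potential for scalar angular momentum $L$ is $$V(r,\theta_1,\theta_2)=\frac{L^2}{2(r^2+B_1+B_2)}-\sum_{u,v\in\{1,2\}}\frac{x_{1u}x_{2v}}{d_{uv}}.$$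 A relative equilibrium (RE) with angular momentum $L$ is a critical point $(r,\theta_1,\theta_2)$, $r>0$, of $V$. It is called (energetically) stable if it is a strict local minimum of $V$ (with $L$ fixed). For $\theta_1=\theta_2=0$ and $r>x_{11}\ell_1+x_{22}\ell_2$ the angular conditions $\partial_{\theta_i}V=0$ hold automatically, and $\partial_rV=0$ is equivalent to $L^2=L^2(r)$, where $$L^2(r)=\frac{(r^2+B_1+B_2)^2}{r}\left(\frac{x_{11}x_{21}}{(R+\ell_1)^2}+\frac{x_{12}x_{22}}{(R+\ell_2)^2}+\frac{x_{11}x_{22}}{(R+1)^2}+\frac{x_{12}x_{21}}{R^2}\right),\quad R=r-x_{11}\ell_1-x_{22}\ell_2>0.$$ *)

theory Defs
  imports "HOL-Analysis.Analysis"
begin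

text \<open>
  Parameters are indexed by the labels 1 and 2: \<open>M i\<close> is the total mass of dumbbell \<open>i\<close>,
  \<open>x i j\<close> the mass fraction of its \<open>j\<close>-th point mass and \<open>l i\<close> the length of its rod.
  For a label \<open>i\<close>, the other label is \<open>3 - i\<close>.
\<close>

definition nontrivial_dumbbells ::
    "(nat \<Rightarrow> real) \<Rightarrow> (nat \<Rightarrow> nat \<Rightarrow> real) \<Rightarrow> (nat \<Rightarrow> real) \<Rightarrow> bool" where
  "nontrivial_dumbbells M x l \<longleftrightarrow>
     (\<forall>i\<in>{1,2}. M i > 0) \<and> M 1 + M 2 = 1 \<and>
     (\<forall>i\<in>{1,2}. \<forall>j\<in>{1,2}. x i j \<in> {0<..<1}) \<and> (\<forall>i\<in>{1,2}. x i 1 + x i 2 = 1) \<and>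
     (\<forall>i\<in>{1,2}. l i > 0) \<and> l 1 + l 2 = 1"

definition mass_position ::
    "(nat \<Rightarrow> real) \<Rightarrow> (nat \<Rightarrow> nat \<Rightarrow> real) \<Rightarrow> (nat \<Rightarrow> real) \<Rightarrow> real \<Rightarrow> (nat \<Rightarrow> real)
      \<Rightarrow> nat \<Rightarrow> nat \<Rightarrow> real \<times> real" where
  "mass_position M x l r \<theta> i j =
     ((-1) ^ i * M (3 - i) * r) *\<^sub>R (1, 0)
     + ((-1) ^ j * x i (3 - j) * l i) *\<^sub>R (cos (\<theta> i), sin (\<theta> i))"

definition mass_distance ::
    "(nat \<Rightarrow> real) \<Rightarrow> (nat \<Rightarrow> nat \<Rightarrow> real) \<Rightarrow> (nat \<Rightarrow> real) \<Rightarrow> real \<Rightarrow> (nat \<Rightarrow> real)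
      \<Rightarrow> nat \<Rightarrow> nat \<Rightarrow> real" where
  "mass_distance M x l r \<theta> u v =
     dist (mass_position M x l r \<theta> 1 u) (mass_position M x l r \<theta> 2 v)"

definition inertia ::
    "(nat \<Rightarrow> real) \<Rightarrow> (nat \<Rightarrow> nat \<Rightarrow> real) \<Rightarrow> (nat \<Rightarrow> real) \<Rightarrow> nat \<Rightarrow> real" where
  "inertia M x l i = x i 1 * x i 2 / M (3 - i) * (l i)\<^sup>2"

text \<open>
  The amended potential is a function of the triple \<open>(r, \<theta>\<^sub>1, \<theta>\<^sub>2)\<close>.  The angles range over all
  reals, i.e. over the universal cover of the torus; this makes no difference to the local
  notions below.  At a collision of masses of different dumbbells the potential takes a
  meaningless finite value, but it is unbounded below nearby, so such a point is neither a
  critical point nor a local minimum.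
\<close>

definition amended_potential ::
    "(nat \<Rightarrow> real) \<Rightarrow> (nat \<Rightarrow> nat \<Rightarrow> real) \<Rightarrow> (nat \<Rightarrow> real) \<Rightarrow> real
      \<Rightarrow> real \<times> real \<times> real \<Rightarrow> real" where
  "amended_potential M x l L = (\<lambda>(r, \<theta>1, \<theta>2).
     L\<^sup>2 / (2 * (r\<^sup>2 + inertia M x l 1 + inertia M x l 2))
     - (\<Sum>u\<in>{1,2}. \<Sum>v\<in>{1,2}.
          x 1 u * x 2 v / mass_distance M x l r (\<lambda>i. if i = 1 then \<theta>1 else \<theta>2) u v))"

definition relative_equilibrium ::
    "(nat \<Rightarrow> real) \<Rightarrow> (nat \<Rightarrow> nat \<Rightarrow> real) \<Rightarrow> (nat \<Rightarrow> real) \<Rightarrow> real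
      \<Rightarrow> real \<times> real \<times> real \<Rightarrow> bool" where
  "relative_equilibrium M x l L p \<longleftrightarrow>
     fst p > 0 \<and> (amended_potential M x l L has_derivative (\<lambda>_. 0)) (at p)"

definition strict_local_min :: "('a::topological_space \<Rightarrow> real) \<Rightarrow> 'a \<Rightarrow> bool" where
  "strict_local_min f p \<longleftrightarrow> (\<forall>\<^sub>F q in at p. f p < f q)"

definition energetically_stable ::
    "(nat \<Rightarrow> real) \<Rightarrow> (nat \<Rightarrow> nat \<Rightarrow> real) \<Rightarrow> (nat \<Rightarrow> real) \<Rightarrow> real
      \<Rightarrow> real \<times> real \<times> real \<Rightarrow> bool" where
  "energetically_stable M x l L p \<longleftrightarrow>
     relative_equilibrium M x l L p \<and> strict_local_min (amended_potential M x l L) p"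

text \<open>
  For \<open>r > x 1 1 * l 1 + x 2 2 * l 2\<close>, the value of \<open>L\<^sup>2\<close> that solves
  \<open>\<partial>V/\<partial>r = 0\<close> at \<open>(r, 0, 0)\<close>; see \<open>relative_equilibrium_colinear_iff\<close> below.
\<close>

definition colinear_L2 ::
    "(nat \<Rightarrow> real) \<Rightarrow> (nat \<Rightarrow> nat \<Rightarrow> real) \<Rightarrow> (nat \<Rightarrow> real) \<Rightarrow> real \<Rightarrow> real" where
  "colinear_L2 M x l r =
     (let R = r - x 1 1 * l 1 - x 2 2 * l 2 in
      (r\<^sup>2 + inertia M x l 1 + inertia M x l 2)\<^sup>2 / r *
      (x 1 1 * x 2 1 / (R + l 1)\<^sup>2 + x 1 2 * x 2 2 / (R + l 2)\<^sup>2
       + x 1 1 * x 2 2 / (R + 1)\<^sup>2 + x 1 2 * x 2 1 / R\<^sup>2))"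

lemma colinear_distance_has_derivative:
  fixes a b r :: real
  assumes "r + b - a > 0"
  shows "((\<lambda>p::real\<times>real\<times>real. sqrt ((fst p + b * cos (snd (snd p)) - a * cos (fst (snd p)))\<^sup>2
     + (b * sin (snd (snd p)) - a * sin (fst (snd p)))\<^sup>2)) has_derivative fst) (at (r,0,0))"
  using assms
  by (auto intro!: derivative_eq_intros simp: fun_eq_iff field_simps power2_eq_square[symmetric])

lemma mass_distance_eq:
  fixes \<theta>1 \<theta>2 r :: real
  assumes "nontrivial_dumbbells M x l"
  shows "mass_distance M x l r (\<lambda>i. if i = 1 then \<theta>1 else \<theta>2) u v =
    sqrt ((r + (-1) ^ v * x 2 (3 - v) * l 2 * cos \<theta>2 - (-1) ^ u * x 1 (3 - u) * l 1 * cos \<theta>1)\<^sup>2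
     + ((-1) ^ v * x 2 (3 - v) * l 2 * sin \<theta>2 - (-1) ^ u * x 1 (3 - u) * l 1 * sin \<theta>1)\<^sup>2)"
proof -
  have m: "M 2 = 1 - M (Suc 0)" using assms(1) by (auto simp: nontrivial_dumbbells_def)
  show ?thesis unfolding mass_distance_def dist_commute[of "mass_position M x l r _ 1 u"]
    by (simp add: mass_position_def dist_Pair_Pair dist_real_def numeral_2_eq_2[symmetric] m algebra_simps)
qed

lemma relative_equilibrium_colinear_iff:
  assumes nt: "nontrivial_dumbbells M x l" and r: "r > x 1 1 * l 1 + x 2 2 * l 2"
  shows "relative_equilibrium M x l L (r,0,0) \<longleftrightarrow> L\<^sup>2 = colinear_L2 M x l r"
proof -
  define R where "R = r - x 1 1 * l 1 - x 2 2 * l 2"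
  define I where "I = inertia M x l 1 + inertia M x l 2"
  note nt' = nt[unfolded nontrivial_dumbbells_def, simplified]
  have pos: "r > 0" using r nt' by (smt (verit) One_nat_def mult_pos_pos)
  have R: "R > 0" using r by (simp add: R_def)
  have I: "I > 0" using nt' by (auto simp: I_def inertia_def intro!: add_pos_pos divide_pos_pos)
  have m: "x (Suc 0) 2 = 1 - x (Suc 0) (Suc 0)" "x 2 (Suc 0) = 1 - x 2 2" "l 2 = 1 - l (Suc 0)"
    and p: "l (Suc 0) > 0" "l (Suc 0) < 1" using nt' by (auto)
  let ?a = "\<lambda>u::nat. (-1) ^ u * x 1 (3 - u) * l 1"
  let ?b = "\<lambda>v::nat. (-1) ^ v * x 2 (3 - v) * l 2"
  have ds: "r + ?b 1 - ?a 1 = R + l 1" "r + ?b 2 - ?a 2 = R + l 2"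
     "r + ?b 2 - ?a 1 = R + 1" "r + ?b 1 - ?a 2 = R"
    by (simp_all add: R_def m numeral_2_eq_2[symmetric] algebra_simps)
  have dpos: "r + ?b v - ?a u > 0" if "u \<in> {1,2}" "v \<in> {1,2}" for u v
    using that ds R p nt' by auto
  define D where "D u v = (\<lambda>p::real\<times>real\<times>real. sqrt ((fst p + ?b v * cos (snd (snd p)) - ?a u * cos (fst (snd p)))\<^sup>2
     + (?b v * sin (snd (snd p)) - ?a u * sin (fst (snd p)))\<^sup>2))" for u v
  have D0: "D u v (r,0,0) = r + ?b v - ?a u" if "u \<in> {1,2}" "v \<in> {1,2}" for u v
    using dpos[OF that] by (simp add: D_def)
  have DD: "(D u v has_derivative fst) (at (r,0,0))" if "u \<in> {1,2}" "v \<in> {1,2}" for u v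
    unfolding D_def by (rule colinear_distance_has_derivative[OF dpos[OF that]])
  have V: "amended_potential M x l L = (\<lambda>p. L\<^sup>2 / (2 * ((fst p)\<^sup>2 + I)) - (\<Sum>u\<in>{1,2}. \<Sum>v\<in>{1,2}. x 1 u * x 2 v / D u v p))"
    by (rule ext) (simp only: amended_potential_def mass_distance_eq[OF nt] D_def I_def split_def add.assoc)
  define S where "S = (\<Sum>u\<in>{1,2}. \<Sum>v\<in>{1,2}. x 1 u * x 2 v / (D u v (r,0,0))\<^sup>2)"
  have t: "((\<lambda>p. x 1 u * x 2 v / D u v p) has_derivative (\<lambda>h. - (x 1 u * x 2 v / (D u v (r,0,0))\<^sup>2) * fst h)) (at (r,0,0))"
    if "u \<in> {1,2}" "v \<in> {1,2}" for u v
    using D0[OF that] dpos[OF that]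
    by (auto intro!: derivative_eq_intros DD[OF that] simp: fun_eq_iff field_simps power2_eq_square)
  have t0: "((\<lambda>p::real\<times>real\<times>real. L\<^sup>2 / (2 * ((fst p)\<^sup>2 + I))) has_derivative (\<lambda>h. - (L\<^sup>2 * r / (r\<^sup>2+I)\<^sup>2) * fst h)) (at (r,0,0))"
  proof -
    have "r\<^sup>2 + I > 0" using I by (simp add: add_nonneg_pos)
    then have "2 * r\<^sup>2 + 2 * I \<noteq> 0" "r\<^sup>2 + I \<noteq> 0" by auto
    then show ?thesis
      by (auto intro!: derivative_eq_intros simp: fun_eq_iff divide_simps) (simp add: algebra_simps power2_eq_square)
  qed
  have dV: "(amended_potential M x l L has_derivative (\<lambda>h. (S - L\<^sup>2 * r / (r\<^sup>2+I)\<^sup>2) * fst h)) (at (r,0,0))"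
    unfolding V
    by (rule has_derivative_eq_rhs[OF has_derivative_diff[OF t0 has_derivative_sum[OF has_derivative_sum[OF t]]]])
       (auto simp: S_def algebra_simps)
  have "relative_equilibrium M x l L (r,0,0) \<longleftrightarrow> S - L\<^sup>2 * r / (r\<^sup>2+I)\<^sup>2 = 0"
  proof
    assume "relative_equilibrium M x l L (r,0,0)"
    then have "(amended_potential M x l L has_derivative (\<lambda>_. 0)) (at (r,0,0))"
      by (simp add: relative_equilibrium_def)
    from has_derivative_unique[OF dV this]
    have "(\<lambda>h::real\<times>real\<times>real. (S - L\<^sup>2 * r / (r\<^sup>2+I)\<^sup>2) * fst h) = (\<lambda>_. 0)" .
    from fun_cong[OF this, of "(1,0,0)"] show "S - L\<^sup>2 * r / (r\<^sup>2+I)\<^sup>2 = 0" by simp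
  next
    assume "S - L\<^sup>2 * r / (r\<^sup>2+I)\<^sup>2 = 0"
    with dV pos show "relative_equilibrium M x l L (r,0,0)" by (simp add: relative_equilibrium_def)
  qed
  also have "\<dots> \<longleftrightarrow> L\<^sup>2 = (r\<^sup>2+I)\<^sup>2 / r * S"
  proof -
    have "r\<^sup>2 + I \<noteq> 0" using I by (smt (verit) zero_le_power2)
    then show ?thesis using pos by (auto simp: field_simps)
  qed
  also have "(r\<^sup>2+I)\<^sup>2 / r * S = colinear_L2 M x l r"
    using D0[of 1 1] D0[of 1 2] D0[of 2 1] D0[of 2 2] unfolding ds
    by (simp add: S_def colinear_L2_def I_def Let_def R_def[symmetric, unfolded One_nat_def] add_ac)
  finally show ?thesis .
qed

end

theory Submission
  imports Defs
begin

text \<open>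
  At fixed \<open>r\<close>, each difference of inverse distances from the colinear position is exactly a weight,
  continuous in the position, times \<open>r a s\<^sub>1\<^sup>2 - r b s\<^sub>2\<^sup>2 + a b s\<^sub>1\<^sub>2\<^sup>2\<close>, where
  \<open>s\<^sub>i = sin (\<theta>\<^sub>i / 2)\<close>, \<open>s\<^sub>1\<^sub>2 = sin ((\<theta>\<^sub>1 - \<theta>\<^sub>2) / 2)\<close> and \<open>a\<close>, \<open>b\<close> are the signed arms of the two
  masses.  Summed up, \<open>V(r, \<theta>\<^sub>1, \<theta>\<^sub>2) - V(r, 0, 0) = A s\<^sub>1\<^sup>2 + B s\<^sub>2\<^sup>2 - K s\<^sub>1\<^sub>2\<^sup>2\<close>, and since
  \<open>\<bar>s\<^sub>1\<^sub>2\<bar> \<le> \<bar>s\<^sub>1\<bar> + \<bar>s\<^sub>2\<bar>\<close> this is positive as soon as \<open>A, B, K > 0\<close> and \<open>K (A + B) < A B\<close>.  These are open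
  conditions, and at every colinear non-overlapped position they hold by convexity of
  \<open>1 / y\<^sup>3\<close>.  So the angles never destabilise, and it remains to see that \<open>V(\<cdot>, 0, 0)\<close> has a strict
  minimum at \<open>r\<close>; its derivative is a positive multiple of \<open>L\<^sup>2(r) - L\<^sup>2\<close>.
\<close>

section \<open>Distances between masses near the colinear position\<close>

text \<open>Only relative position matters: each center of mass carries its rod, and
  \<open>a\<close>, \<open>b\<close> are the signed arms of one mass of dumbbell 1 and one of
  dumbbell 2.\<close>

definition separation :: "real \<Rightarrow> real \<Rightarrow> real \<times> real \<times> real \<Rightarrow> real" where
  "separation a b = (\<lambda>(r, \<theta>1, \<theta>2).
     sqrt ((r + b * cos \<theta>2 - a * cos \<theta>1)\<^sup>2 + (b * sin \<theta>2 - a * sin \<theta>1)\<^sup>2))"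

text \<open>With d the actual and D the colinear distance, 1/D - 1/d = (d^2 - D^2) / (d D (d + D)).
  The weight is that last factor, times the 4 from the half-angle formula; it stays regular where d
  = D.\<close>

definition separation_weight :: "real \<Rightarrow> real \<Rightarrow> real \<times> real \<times> real \<Rightarrow> real" where
  "separation_weight a b q =
     4 / (separation a b q * (fst q + b - a) * (separation a b q + (fst q + b - a)))"

text \<open>Expand the squared length of a sum of three plane vectors and replace each 1 - cos t by
  2 sin^2 (t/2).\<close>

lemma separation_squared:
  "(separation a b (r, \<theta>1, \<theta>2))\<^sup>2 =
     (r + b - a)\<^sup>2 + 4 * (r * a * (sin (\<theta>1 / 2))\<^sup>2 - r * b * (sin (\<theta>2 / 2))\<^sup>2
       + a * b * (sin ((\<theta>1 - \<theta>2) / 2))\<^sup>2)"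
proof -
  have half: "4 * (sin (t / 2))\<^sup>2 = 2 - 2 * cos t" for t :: real
    using cos_double_sin[of "t / 2"] by simp
  have "(separation a b (r, \<theta>1, \<theta>2))\<^sup>2 =
      (r + b * cos \<theta>2 - a * cos \<theta>1)\<^sup>2 + (b * sin \<theta>2 - a * sin \<theta>1)\<^sup>2"
    by (simp add: separation_def)
  also have "\<dots> = r\<^sup>2 + b\<^sup>2 * ((sin \<theta>2)\<^sup>2 + (cos \<theta>2)\<^sup>2) + a\<^sup>2 * ((sin \<theta>1)\<^sup>2 + (cos \<theta>1)\<^sup>2)
      + 2 * r * b * cos \<theta>2 - 2 * r * a * cos \<theta>1 - 2 * a * b * cos (\<theta>1 - \<theta>2)"
    unfolding cos_diff by algebra
  also have "\<dots> = (r + b - a)\<^sup>2 + (r * a * (2 - 2 * cos \<theta>1) - r * b * (2 - 2 * cos \<theta>2)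
      + a * b * (2 - 2 * cos (\<theta>1 - \<theta>2)))"
    by (simp add: power2_eq_square algebra_simps)
  finally show ?thesis
    unfolding half[symmetric] by (simp add: algebra_simps)
qed

lemma separation_colinear: "r + b - a > 0 \<Longrightarrow> separation a b (r, 0, 0) = r + b - a"
  by (simp add: separation_def)

lemma inverse_separation_diff:
  assumes "r + b - a > 0" and "separation a b (r, \<theta>1, \<theta>2) > 0"
  shows "1 / (r + b - a) - 1 / separation a b (r, \<theta>1, \<theta>2) =
    separation_weight a b (r, \<theta>1, \<theta>2) *
      (r * a * (sin (\<theta>1 / 2))\<^sup>2 - r * b * (sin (\<theta>2 / 2))\<^sup>2 + a * b * (sin ((\<theta>1 - \<theta>2) / 2))\<^sup>2)"
    (is "_ = _ * ?\<delta>")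
proof -
  define d D where "d = separation a b (r, \<theta>1, \<theta>2)" and "D = r + b - a"
  have "4 * ?\<delta> = (d - D) * (d + D)"
    using separation_squared[of a b r \<theta>1 \<theta>2] by (simp add: d_def D_def power2_eq_square algebra_simps)
  then have "4 / (d * D * (d + D)) * ?\<delta> = (d - D) * (d + D) / (d * D * (d + D))"
    by simp
  also have "\<dots> = 1 / D - 1 / d"
  proof -
    have "d > 0" "D > 0" "d + D \<noteq> 0" using assms by (auto simp: d_def D_def)
    then show ?thesis by (simp add: diff_divide_distrib)
  qed
  finally show ?thesis by (simp add: separation_weight_def d_def D_def)
qed

lemma isCont_separation: "isCont (separation a b) q"
  unfolding separation_def split_def by (intro continuous_intros)

lemma isCont_separation_weight:
  assumes "r + b - a > 0"
  shows "isCont (separation_weight a b) (r, 0, 0)"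
  unfolding separation_weight_def using assms
  by (intro continuous_intros isCont_separation) (auto simp: separation_colinear)

lemma separation_weight_colinear:
  assumes "r + b - a > 0"
  shows "separation_weight a b (r, 0, 0) = 2 / (r + b - a) ^ 3"
proof -
  define D where "D = r + b - a"
  have "separation_weight a b (r, 0, 0) = 4 / (D * D * (D + D))"
    using assms by (simp add: separation_weight_def separation_colinear D_def)
  also have "\<dots> = 2 / D ^ 3"
    using assms by (simp add: D_def[symmetric] field_simps power3_eq_cube)
  finally show ?thesis by (simp add: D_def)
qed

section \<open>Definiteness of the angular form\<close>

text \<open>The drop of 1/z^3 over a step \<open>h\<close> factors into positive terms that decrease
  in z, so it is smaller from \<open>y + k\<close> than from \<open>y\<close>.\<close>

lemma inverse_cube_strict_convex:
  fixes y h k :: real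
  assumes "y > 0" "h > 0" "k > 0"
  shows "1 / (y + h) ^ 3 + 1 / (y + k) ^ 3 < 1 / y ^ 3 + 1 / (y + h + k) ^ 3"
proof -
  have diff_cubes: "u ^ 3 - v ^ 3 = (u - v) * (u\<^sup>2 + u * v + v\<^sup>2)" for u v :: real
    by algebra
  have split: "1 / z ^ 3 - 1 / (z + h) ^ 3 =
      h * (1 / (z * (z + h))) * (1 / z\<^sup>2 + 1 / (z * (z + h)) + 1 / (z + h)\<^sup>2)" if "z > 0" for z
  proof -
    have "1 / z - 1 / (z + h) = h * (1 / (z * (z + h)))"
      using that assms by (simp add: field_simps)
    moreover have "1 / z ^ 3 - 1 / (z + h) ^ 3 =
        (1 / z - 1 / (z + h)) * (1 / z\<^sup>2 + 1 / (z * (z + h)) + 1 / (z + h)\<^sup>2)"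
      using diff_cubes[of "1 / z" "1 / (z + h)"] by (simp add: power_divide)
    ultimately show ?thesis by simp
  qed
  have "1 / ((y + k) * (y + k + h)) < 1 / (y * (y + h))"
    using assms by (intro divide_strict_left_mono mult_strict_mono) auto
  moreover have "1 / (y + k)\<^sup>2 < 1 / y\<^sup>2" "1 / (y + k + h)\<^sup>2 < 1 / (y + h)\<^sup>2"
    using assms by (auto intro!: divide_strict_left_mono power_strict_mono)
  ultimately have "h * (1 / ((y + k) * (y + k + h))) * (1 / (y + k)\<^sup>2 + 1 / ((y + k) * (y + k + h)) + 1 / (y + k + h)\<^sup>2)
     < h * (1 / (y * (y + h))) * (1 / y\<^sup>2 + 1 / (y * (y + h)) + 1 / (y + h)\<^sup>2)"
    using assms by (intro mult_strict_mono mult_strict_left_mono add_strict_mono add_nonneg_nonneg) auto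
  with split[of y] split[of "y + k"] assms show ?thesis by (simp add: add.commute add.left_commute)
qed

text \<open>After bounding \<open>c\<close>, this concerns the quadratic form A u^2 + B v^2 - K (u +
  v)^2, whose determinant is AB - K (A + B).\<close>

lemma sum_minus_cross_pos:
  fixes A B K s t c :: real
  assumes "A > 0" "B > 0" "K > 0" "K * (A + B) < A * B"
    and "c\<^sup>2 \<le> (\<bar>s\<bar> + \<bar>t\<bar>)\<^sup>2" and "s \<noteq> 0 \<or> t \<noteq> 0"
  shows "A * s\<^sup>2 + B * t\<^sup>2 - K * c\<^sup>2 > 0"
proof -
  define u v where "u = \<bar>s\<bar>" and "v = \<bar>t\<bar>"
  have uv: "u \<ge> 0" "v \<ge> 0" "u + v > 0" using assms(6) by (auto simp: u_def v_def)
  \<comment> \<open>Cauchy-Schwarz in the form \<open>(u + v)\<^sup>2 \<le> (1 / A + 1 / B) (A u\<^sup>2 + B v\<^sup>2)\<close>\<close>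
  have "(A + B) * (A * u\<^sup>2 + B * v\<^sup>2) - A * B * (u + v)\<^sup>2 = (A * u - B * v)\<^sup>2"
    by (simp add: power2_eq_square algebra_simps)
  then have "A * B * (u + v)\<^sup>2 \<le> (A + B) * (A * u\<^sup>2 + B * v\<^sup>2)" by (smt (verit) zero_le_power2)
  moreover have "K * (A + B) * (u + v)\<^sup>2 < A * B * (u + v)\<^sup>2"
    using assms(4) uv(3) by (intro mult_strict_right_mono) auto
  ultimately have "(A + B) * (K * (u + v)\<^sup>2) < (A + B) * (A * u\<^sup>2 + B * v\<^sup>2)"
    by (simp add: mult_ac)
  then have "K * (u + v)\<^sup>2 < A * u\<^sup>2 + B * v\<^sup>2" using assms(1,2) by simp
  moreover have "K * c\<^sup>2 \<le> K * (u + v)\<^sup>2"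
    using assms(3,5) by (simp add: u_def v_def)
  ultimately show ?thesis by (simp add: u_def v_def)
qed

lemma sin_half_diff_squared_le:
  fixes s t :: real
  shows "(sin ((s - t) / 2))\<^sup>2 \<le> (\<bar>sin (s / 2)\<bar> + \<bar>sin (t / 2)\<bar>)\<^sup>2"
proof -
  have "\<bar>sin (s/2) * cos (t/2) - cos (s/2) * sin (t/2)\<bar> \<le> \<bar>sin (s/2)\<bar> * \<bar>cos (t/2)\<bar> + \<bar>cos (s/2)\<bar> * \<bar>sin (t/2)\<bar>"
    by (metis abs_mult abs_triangle_ineq4)
  also have "\<dots> \<le> \<bar>sin (s/2)\<bar> * 1 + 1 * \<bar>sin (t/2)\<bar>"
    by (intro add_mono mult_left_mono mult_right_mono) auto
  finally have "\<bar>sin ((s - t) / 2)\<bar> \<le> \<bar>sin (s/2)\<bar> + \<bar>sin (t/2)\<bar>"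
    by (simp add: diff_divide_distrib sin_diff)
  then show ?thesis by (rule abs_le_square_iff[THEN iffD1, OF order_trans]) simp
qed

lemma angular_form_definite:
  fixes r R x11 x12 x21 x22 l1 l2 :: real
  assumes x: "x11 > 0" "x12 > 0" "x21 > 0" "x22 > 0" "x11 + x12 = 1" "x21 + x22 = 1"
    and l: "l1 > 0" "l2 > 0" "l1 + l2 = 1"
    and R: "R > 0" "r = R + x11 * l1 + x22 * l2"
    and w: "w11 = 2 / (R + l1) ^ 3" "w22 = 2 / (R + l2) ^ 3" "w12 = 2 / (R + 1) ^ 3" "w21 = 2 / R ^ 3"
    and A: "A = r * x11 * x12 * l1 * (x21 * (w21 - w11) + x22 * (w22 - w12))"
    and B: "B = r * x21 * x22 * l2 * (x11 * (w11 - w12) + x12 * (w21 - w22))"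
    and K: "K = x11 * x12 * x21 * x22 * l1 * l2 * (w21 + w12 - w11 - w22)"
  shows "A > 0" "B > 0" "K > 0" "K * (A + B) < A * B"
proof -
  \<comment> \<open>Up to the factor 2, a second difference of 1/y^3: R and R + 1 have the same sum
    as R + l1 and R + l2.\<close>
  define k where "k = w21 + w12 - w11 - w22"
  have k: "k > 0"
    using inverse_cube_strict_convex[of R l1 l2] R l by (simp add: k_def w add.assoc)
  have z: "w22 - w12 > 0" "w11 - w12 > 0"
    using R l by (auto simp: w intro!: divide_strict_left_mono power_strict_mono)
  have r: "r > 0" using R x l by (simp add: add_pos_pos)
  \<comment> \<open>Splitting off the \<open>k\<close> part makes \<open>A\<close> and
    \<open>B\<close> comparable with \<open>K\<close>, which is a multiple of
    \<open>k\<close>.\<close>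
  have A': "A = r * x11 * x12 * l1 * (w22 - w12 + x21 * k)"
  proof -
    have "x22 = 1 - x21" using x by simp
    then show ?thesis unfolding A k_def by algebra
  qed
  have B': "B = r * x21 * x22 * l2 * (w11 - w12 + x12 * k)"
  proof -
    have "x11 = 1 - x12" using x by simp
    then show ?thesis unfolding B k_def by algebra
  qed
  show K0: "K > 0" using k x l by (simp add: K k_def[symmetric])
  \<comment> \<open>\<open>K / A < x22 l2 / r\<close> and \<open>K / B < x11 l1 / r\<close>, and these bounds add up to less than 1.\<close>
  have "K * r = x22 * l2 * (r * x11 * x12 * l1 * (x21 * k))" by (simp add: K k_def)
  also have "\<dots> < x22 * l2 * A"
    unfolding A' using z x l r by (intro mult_strict_left_mono) auto
  finally have KA: "K * r < x22 * l2 * A" .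
  have "K * r = x11 * l1 * (r * x21 * x22 * l2 * (x12 * k))" by (simp add: K k_def)
  also have "\<dots> < x11 * l1 * B"
    unfolding B' using z x l r by (intro mult_strict_left_mono) auto
  finally have KB: "K * r < x11 * l1 * B" .
  show A0: "A > 0" using z k x l r by (simp add: A' add_pos_pos)
  show B0: "B > 0" using z k x l r by (simp add: B' add_pos_pos)
  have "r * (K * (A + B)) = (K * r) * B + (K * r) * A" by (simp add: algebra_simps)
  also have "\<dots> < (x22 * l2 * A) * B + (x11 * l1 * B) * A"
    using KA KB A0 B0 by (intro add_strict_mono mult_strict_right_mono)
  also have "\<dots> = (x11 * l1 + x22 * l2) * (A * B)" by (simp add: algebra_simps)
  \<comment> \<open>The gap \<open>R\<close> is positive, so x11 l1 + x22 l2 < r.\<close>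
  also have "\<dots> < r * (A * B)"
    using R A0 B0 by (intro mult_strict_right_mono) auto
  finally show "K * (A + B) < A * B" using r by simp
qed

text \<open>First derivative test: for the radial direction the sign of L^2(y) - L^2 then suffices,
  without second derivatives of the potential.\<close>

lemma strict_min_deriv_sign:
  fixes f f' :: "real \<Rightarrow> real"
  assumes f: "\<And>y. \<bar>y - r\<bar> < e \<Longrightarrow> (f has_real_derivative f' y) (at y)"
    and pos: "\<And>y. \<bar>y - r\<bar> < e \<Longrightarrow> r < y \<Longrightarrow> f' y > 0"
    and neg: "\<And>y. \<bar>y - r\<bar> < e \<Longrightarrow> y < r \<Longrightarrow> f' y < 0"
    and y: "\<bar>y - r\<bar> < e" "y \<noteq> r"
  shows "f r < f y"
proof -
  have cont: "continuous_on S f" if "\<And>z. z \<in> S \<Longrightarrow> \<bar>z - r\<bar> < e" for S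
    using that f by (meson DERIV_isCont continuous_at_imp_continuous_on)
  consider "r < y" | "y < r" using y by linarith
  then show ?thesis
  proof cases
    case 1
    show ?thesis
      by (rule DERIV_pos_imp_increasing_open[OF 1]) (use y 1 in \<open>auto intro!: exI f pos cont\<close>)
  next
    case 2
    show ?thesis
      by (rule DERIV_neg_imp_decreasing_open[OF 2]) (use y 2 in \<open>auto intro!: exI f neg cont\<close>)
  qed
qed

theorem theorem5p3p2:
  fixes M :: "nat \<Rightarrow> real" and x :: "nat \<Rightarrow> nat \<Rightarrow> real" and l :: "nat \<Rightarrow> real"
    and L r :: real
  assumes "nontrivial_dumbbells M x l"
    and "r > x 1 1 * l 1 + x 2 2 * l 2"
    and "relative_equilibrium M x l L (r, 0, 0)"
    and "deriv (colinear_L2 M x l) r > 0"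
  shows "energetically_stable M x l L (r, 0, 0)"
proof -
  define x11 x12 x21 x22 l1 l2 where
    "x11 = x 1 1" "x12 = x 1 2" "x21 = x 2 1" "x22 = x 2 2" "l1 = l 1" "l2 = l 2"
  note xs = this
  note nt = assms(1)[unfolded nontrivial_dumbbells_def, folded xs]
  have x: "x11 > 0" "x12 > 0" "x21 > 0" "x22 > 0" "x11 + x12 = 1" "x21 + x22 = 1"
    and l: "l1 > 0" "l2 > 0" "l1 + l2 = 1"
    using nt by (auto simp: xs)
  have x': "x11 = 1 - x12" "x21 = 1 - x22" "l2 = 1 - l1" using x l by auto
  \<comment> \<open>The radius at which the inner masses, with fractions \<open>x12\<close> and
    \<open>x21\<close>, would collide.\<close>
  define c where "c = x11 * l1 + x22 * l2"
  have c: "c > 0" using x l by (simp add: c_def add_pos_pos)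
  define I where "I = inertia M x l 1 + inertia M x l 2"
  have I: "I > 0"
    using assms(1) by (auto simp: I_def inertia_def nontrivial_dumbbells_def intro!: add_pos_pos divide_pos_pos)
  have rc: "r > c" using assms(2) by (simp add: c_def xs)
  define a1 a2 b1 b2 where "a1 = - x12 * l1" "a2 = x11 * l1" "b1 = - x22 * l2" "b2 = x21 * l2"
  note ab = this
  have ds: "y + b1 - a1 = y - c + l1" "y + b2 - a2 = y - c + l2" "y + b2 - a1 = y - c + 1" "y + b1 - a2 = y - c" for y
    by (simp_all add: ab c_def x' algebra_simps)
  have V: "amended_potential M x l L q = L\<^sup>2 / (2 * ((fst q)\<^sup>2 + I))
      - (x11 * x21 / separation a1 b1 q + x11 * x22 / separation a1 b2 q
       + x12 * x21 / separation a2 b1 q + x12 * x22 / separation a2 b2 q)" for q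
    by (cases q) (simp add: amended_potential_def mass_distance_eq[OF assms(1), unfolded One_nat_def] separation_def ab xs I_def
        numeral_2_eq_2[symmetric] add.assoc)
  have V0: "amended_potential M x l L (y, 0, 0) = L\<^sup>2 / (2 * (y\<^sup>2 + I))
      - (x11 * x21 / (y - c + l1) + x11 * x22 / (y - c + 1) + x12 * x21 / (y - c) + x12 * x22 / (y - c + l2))"
    if "y > c" for y
    using that l by (simp add: V separation_colinear ds)
  define w11 w12 w21 w22 where
    "w11 = separation_weight a1 b1" "w12 = separation_weight a1 b2"
    "w21 = separation_weight a2 b1" "w22 = separation_weight a2 b2"
  note w = this
  \<comment> \<open>\<open>A\<close>, \<open>B\<close> and -\<open>K\<close> collect the
    coefficients of the three squared sines over the four pairs; opposite signs of the two arms on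
    each rod produce the differences of weights.\<close>
  define A where "A q = fst q * x11 * x12 * l1 * (x21 * (w21 q - w11 q) + x22 * (w22 q - w12 q))" for q
  define B where "B q = fst q * x21 * x22 * l2 * (x11 * (w11 q - w12 q) + x12 * (w21 q - w22 q))" for q
  define K where "K q = x11 * x12 * x21 * x22 * l1 * l2 * (w21 q + w12 q - w11 q - w22 q)" for q
  let ?p = "(r, 0, 0) :: real \<times> real \<times> real"
  have wc: "isCont w11 ?p" "isCont w12 ?p" "isCont w21 ?p" "isCont w22 ?p"
    unfolding w using rc l by (auto intro!: isCont_separation_weight simp: ds)
  have cont: "isCont A ?p" "isCont B ?p" "isCont K ?p"
    unfolding A_def B_def K_def by (intro continuous_intros wc)+
  then have cont_disc: "isCont (\<lambda>q. A q * B q - K q * (A q + B q)) ?p"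
    by (intro continuous_intros)
  have "A ?p > 0 \<and> B ?p > 0 \<and> K ?p > 0 \<and> K ?p * (A ?p + B ?p) < A ?p * B ?p"
    using angular_form_definite[OF x l, of "r - c" r "w11 ?p" "w22 ?p" "w12 ?p" "w21 ?p" "A ?p" "B ?p" "K ?p"] rc l
    by (auto simp: A_def B_def K_def w separation_weight_colinear ds c_def)
  then have "0 < A ?p" "0 < B ?p" "0 < K ?p" "0 < A ?p * B ?p - K ?p * (A ?p + B ?p)" by auto
  then have ev: "\<forall>\<^sub>F q in at ?p. 0 < A q" "\<forall>\<^sub>F q in at ?p. 0 < B q" "\<forall>\<^sub>F q in at ?p. 0 < K q"
      "\<forall>\<^sub>F q in at ?p. 0 < A q * B q - K q * (A q + B q)"
    using cont[THEN isContD, THEN order_tendstoD(1)] cont_disc[THEN isContD, THEN order_tendstoD(1)]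
    by blast+
  have evs: "\<forall>\<^sub>F q in at ?p. 0 < separation a b q" if "r + b - a > 0" for a b
    using that by (intro order_tendstoD(1)[OF isContD[OF isCont_separation]]) (simp add: separation_colinear)
  have coord: "isCont fst ?p" "isCont (\<lambda>q. fst (snd q)) ?p" "isCont (\<lambda>q. snd (snd q)) ?p"
    by (intro continuous_intros)+

  \<comment> \<open>Turning the rods at fixed radius raises the potential\<close>
  have angular: "\<forall>\<^sub>F q in at ?p. snd q \<noteq> (0, 0) \<longrightarrow>
      amended_potential M x l L (fst q, 0, 0) < amended_potential M x l L q"
  proof -
    have "\<forall>\<^sub>F q in at ?p. c < fst q"
      using order_tendstoD(1)[OF isContD[OF coord(1)]] rc by simp
    \<comment> \<open>The angles live on the universal cover; below pi in absolute value, a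
      half-angle sine vanishes only at angle 0.\<close>
    moreover have "\<forall>\<^sub>F q in at ?p. \<bar>fst (snd q)\<bar> < pi"
      using order_tendstoD(2)[OF isContD[OF continuous_rabs[OF coord(2)]], of pi] by simp
    moreover have "\<forall>\<^sub>F q in at ?p. \<bar>snd (snd q)\<bar> < pi"
      using order_tendstoD(2)[OF isContD[OF continuous_rabs[OF coord(3)]], of pi] by simp
    moreover have "\<forall>\<^sub>F q in at ?p. 0 < separation a1 b1 q" "\<forall>\<^sub>F q in at ?p. 0 < separation a1 b2 q"
      "\<forall>\<^sub>F q in at ?p. 0 < separation a2 b1 q" "\<forall>\<^sub>F q in at ?p. 0 < separation a2 b2 q"
      using rc l by (auto intro!: evs simp: ds)
    ultimately show ?thesis using ev
    proof eventually_elim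
      case (elim q)
      obtain y s t where q: "q = (y, s, t)" by (cases q)
      note el = elim[unfolded q fst_conv snd_conv]
      show ?case
      proof
        assume "snd q \<noteq> (0, 0)"
        then have "sin (s / 2) \<noteq> 0 \<or> sin (t / 2) \<noteq> 0"
          using el(2,3) sin_zero_pi_iff[of "s/2"] sin_zero_pi_iff[of "t/2"] by (auto simp: q)
        then have "0 < A q * (sin (s/2))\<^sup>2 + B q * (sin (t/2))\<^sup>2 - K q * (sin ((s - t) / 2))\<^sup>2"
          using elim by (intro sum_minus_cross_pos sin_half_diff_squared_le) auto
        also have "\<dots> = x11 * x21 * (1 / (y + b1 - a1) - 1 / separation a1 b1 (y,s,t))
           + x11 * x22 * (1 / (y + b2 - a1) - 1 / separation a1 b2 (y,s,t))
           + x12 * x21 * (1 / (y + b1 - a2) - 1 / separation a2 b1 (y,s,t))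
           + x12 * x22 * (1 / (y + b2 - a2) - 1 / separation a2 b2 (y,s,t))"
          using el l
          by (subst (1 2 3 4) inverse_separation_diff)
            (auto simp: ds A_def B_def K_def w[symmetric] q, simp add: ab algebra_simps)
        also have "\<dots> = amended_potential M x l L q - amended_potential M x l L (y, 0, 0)"
          unfolding V0[OF el(1)] q V[of "(y, s, t)"] fst_conv ds by (simp add: algebra_simps)
        finally show "amended_potential M x l L (fst q, 0, 0) < amended_potential M x l L q"
          by (simp add: q)
      qed
    qed
  qed

  \<comment> \<open>Strict radial minimum at angles zero\<close>
  define S where "S y = x11 * x21 / (y - c + l1)\<^sup>2 + x12 * x22 / (y - c + l2)\<^sup>2
     + x11 * x22 / (y - c + 1)\<^sup>2 + x12 * x21 / (y - c)\<^sup>2" for y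
  have L2: "colinear_L2 M x l y = (y\<^sup>2 + I)\<^sup>2 / y * S y" for y
    by (simp add: colinear_L2_def Let_def S_def I_def c_def xs add.assoc diff_diff_eq)
  have L: "L\<^sup>2 = colinear_L2 M x l r"
    using relative_equilibrium_colinear_iff[OF assms(1,2)] assms(3) by blast
  \<comment> \<open>\<open>deriv\<close> is an arbitrary choice without differentiability, so this
    must come before its sign can be used.\<close>
  have "colinear_L2 M x l differentiable at r"
    unfolding L2[abs_def] S_def using rc c l
    by (intro derivative_intros differentiable_mult differentiable_divide) auto
  then have L2d: "(colinear_L2 M x l has_real_derivative deriv (colinear_L2 M x l) r) (at r)"
    using DERIV_deriv_iff_real_differentiable by blast
  \<comment> \<open>A positive derivative at the single point \<open>r\<close> does not make L^2
    monotone nearby, but it does compare nearby values with L^2(r), which fixes the sign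
    needed.\<close>
  obtain e1 where e1: "e1 > 0" "\<And>h. h > 0 \<Longrightarrow> h < e1 \<Longrightarrow> colinear_L2 M x l r < colinear_L2 M x l (r + h)"
    using DERIV_pos_inc_right[OF L2d assms(4)] by blast
  obtain e2 where e2: "e2 > 0" "\<And>h. h > 0 \<Longrightarrow> h < e2 \<Longrightarrow> colinear_L2 M x l (r - h) < colinear_L2 M x l r"
    using DERIV_pos_inc_left[OF L2d assms(4)] by blast
  define e where "e = min (min e1 e2) (r - c)"
  have e: "e > 0" using e1 e2 rc by (simp add: e_def)
  have radial: "amended_potential M x l L (r, 0, 0) < amended_potential M x l L (y, 0, 0)"
    if y: "\<bar>y - r\<bar> < e" "y \<noteq> r" for y
  proof (rule strict_min_deriv_sign[where f = "\<lambda>y. amended_potential M x l L (y, 0, 0)"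
        and f' = "\<lambda>y. y / (y\<^sup>2 + I)\<^sup>2 * (colinear_L2 M x l y - L\<^sup>2)", OF _ _ _ y])
    fix y assume y: "\<bar>y - r\<bar> < e"
    then have yc: "y > c" by (auto simp: e_def)
    with c have y0: "y > 0" by simp
    have q: "y\<^sup>2 + I > 0" using I by (simp add: add_nonneg_pos)
    then have fac: "y / (y\<^sup>2 + I)\<^sup>2 > 0" using y0 by simp
    have "((\<lambda>y. L\<^sup>2 / (2 * (y\<^sup>2 + I))) has_real_derivative - (y / (y\<^sup>2 + I)\<^sup>2 * L\<^sup>2)) (at y)"
    proof -
      have "((\<lambda>y. m / (y\<^sup>2 + I)) has_real_derivative - (m * (2 * y)) / (y\<^sup>2 + I)\<^sup>2) (at y)" for m
        using q by (auto intro!: derivative_eq_intros simp: power2_eq_square)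
      from this[of "L\<^sup>2 / 2"] show ?thesis by (simp add: mult.commute)
    qed
    moreover have "((\<lambda>y. m / (y - c + k)) has_real_derivative - (m / (y - c + k)\<^sup>2)) (at y)" if "k \<ge> 0" for m k
      using that yc by (auto intro!: derivative_eq_intros simp: power2_eq_square)
    \<comment> \<open>Taking \<open>k = 0\<close> treats the inner pair like the other three, hence
      the \<open>+ 0\<close> below.\<close>
    note d = this[of l1 "x11 * x21"] this[of 1 "x11 * x22"] this[of 0 "x12 * x21"] this[of l2 "x12 * x22"]
    ultimately have "((\<lambda>y. L\<^sup>2 / (2 * (y\<^sup>2 + I))
      - (x11 * x21 / (y - c + l1) + x11 * x22 / (y - c + 1) + x12 * x21 / (y - c + 0) + x12 * x22 / (y - c + l2)))
      has_real_derivative - (y / (y\<^sup>2 + I)\<^sup>2 * L\<^sup>2) - (- (x11 * x21 / (y - c + l1)\<^sup>2) + - (x11 * x22 / (y - c + 1)\<^sup>2)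
        + - (x12 * x21 / (y - c + 0)\<^sup>2) + - (x12 * x22 / (y - c + l2)\<^sup>2))) (at y)"
      using l by (intro DERIV_diff DERIV_add d) auto
    moreover have "- (y / (y\<^sup>2 + I)\<^sup>2 * L\<^sup>2) - (- (x11 * x21 / (y - c + l1)\<^sup>2) + - (x11 * x22 / (y - c + 1)\<^sup>2)
        + - (x12 * x21 / (y - c + 0)\<^sup>2) + - (x12 * x22 / (y - c + l2)\<^sup>2)) =
        y / (y\<^sup>2 + I)\<^sup>2 * (colinear_L2 M x l y - L\<^sup>2)"
    proof -
      have "y / (y\<^sup>2 + I)\<^sup>2 * colinear_L2 M x l y = S y" using y0 q by (simp add: L2)
      then show ?thesis by (simp add: right_diff_distrib S_def)
    qed
    \<comment> \<open>The explicit formula \<open>V0\<close> holds only for y > c, so the derivative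
      is transferred on that open set.\<close>
    ultimately show "((\<lambda>y. amended_potential M x l L (y, 0, 0)) has_real_derivative
        y / (y\<^sup>2 + I)\<^sup>2 * (colinear_L2 M x l y - L\<^sup>2)) (at y)"
      by (rule_tac has_field_derivative_transform_within_open[of _ _ _ "{c<..}"]) (use yc in \<open>auto simp: V0\<close>)
    show "y / (y\<^sup>2 + I)\<^sup>2 * (colinear_L2 M x l y - L\<^sup>2) > 0" if "r < y"
      using e1(2)[of "y - r"] that y by (intro mult_pos_pos fac) (auto simp: L e_def)
    show "y / (y\<^sup>2 + I)\<^sup>2 * (colinear_L2 M x l y - L\<^sup>2) < 0" if "y < r"
      using e2(2)[of "r - y"] that y by (intro mult_pos_neg fac) (auto simp: L e_def)
  qed

  \<comment> \<open>Combining the two directions\<close>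
  have "\<forall>\<^sub>F q in at ?p. \<bar>fst q - r\<bar> < e"
    using order_tendstoD(2)[OF isContD[OF continuous_rabs[OF continuous_diff[OF coord(1) continuous_const]]], of r e] e
    by simp
  moreover have "\<forall>\<^sub>F q in at ?p. q \<noteq> ?p"
    by (simp add: eventually_at_filter)
  ultimately have "\<forall>\<^sub>F q in at ?p. amended_potential M x l L ?p < amended_potential M x l L q"
    using angular
  proof eventually_elim
    case (elim q)
    \<comment> \<open>Change the radius first, then the angles. Either move may be trivial, but not
      both, since \<open>q\<close> differs from the equilibrium.\<close>
    then show ?case using radial[of "fst q"]
      by (cases q) (metis fst_conv snd_conv less_trans)
  qed
  then show ?thesis
    using assms(3) by (simp add: energetically_stable_def strict_local_min_def)
qed

end
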